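(* Let $n\geq 3$ be an integer, and write $n=2^{k}m$, where $k\geq 0$ and $m$ is a positive odd integer. Then $$\alpha\bigl(\Theta(SD_{8n})\bigr)=6n-2m.$$
   Context: $SD_{8n}=\langle a,b : a^{4n}=1,\ b^2=1,\ bab^{-1}=a^{2n-1}\rangle$ is the semidihedral group of order $8n$. For a finite group $G$, $|g|$ denotes the order of $g\in G$, and the prime-coprime graph $\Theta(G)$ is the simple graph with vertex set $G$ in which two distinct vertices $g,h$ are adjacent if and only if $\gcd(|g|,|h|)$ is either $1$ or a prime. The independence number $\alpha(\Gamma)$ of a graph $\Gamma$ is the maximum cardinality of an independent set of $\Gamma$. *)

theory Defs
  imports
    "HOL-Algebra.Multiplicative_Group"
    "HOL-Computational_Algebra.Primes"
    "Graph_Theory.Pair_Digraph"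
begin

section \<open>Groups given by generators and relations\<close>

text \<open>
  A word is a list of letters; the letter \<open>(x, True)\<close> stands for the generator \<open>x\<close> and
  \<open>(x, False)\<close> for its formal inverse. A relation \<open>(u, v)\<close> stands for the equation \<open>u = v\<close>.
  All elements of the type \<open>'x\<close> are generators.
\<close>

type_synonym 'x word = "('x \<times> bool) list"

text \<open>The least congruence on words that contains the relations and cancels
  each letter against its inverse.\<close>

inductive word_eq :: "('x word \<times> 'x word) set \<Rightarrow> 'x word \<Rightarrow> 'x word \<Rightarrow> bool"
  for R :: "('x word \<times> 'x word) set" where
  refl: "word_eq R u u"
| sym: "word_eq R u v \<Longrightarrow> word_eq R v u"
| trans: "word_eq R u v \<Longrightarrow> word_eq R v w \<Longrightarrow> word_eq R u w"
| append: "word_eq R u u' \<Longrightarrow> word_eq R v v' \<Longrightarrow> word_eq R (u @ v) (u' @ v')"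
| cancel: "word_eq R [(x, s), (x, \<not> s)] []"
| relation: "(u, v) \<in> R \<Longrightarrow> word_eq R u v"

definition word_class :: "('x word \<times> 'x word) set \<Rightarrow> 'x word \<Rightarrow> 'x word set" where
  "word_class R u = {v. word_eq R u v}"

definition presented_group :: "('x word \<times> 'x word) set \<Rightarrow> 'x word set monoid" where
  "presented_group R =
    \<lparr>carrier = range (word_class R),
     monoid.mult = (\<lambda>U V. \<Union>u\<in>U. \<Union>v\<in>V. word_class R (u @ v)),
     monoid.one = word_class R []\<rparr>"

lemma word_class_eq_iff: "word_class R u = word_class R v \<longleftrightarrow> word_eq R u v"
  unfolding word_class_def by (auto intro: word_eq.intros)

lemma presented_group_mult:
  "word_class R u \<otimes>\<^bsub>presented_group R\<^esub> word_class R v = word_class R (u @ v)"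
  unfolding presented_group_def word_class_def
  by (auto intro: word_eq.intros)

lemma word_eq_left_inverse:
  "word_eq R (rev (map (\<lambda>(x, s). (x, \<not> s)) u) @ u) []"
proof (induction u)
  case Nil
  show ?case by (simp add: word_eq.refl)
next
  case (Cons l u)
  obtain x s where l: "l = (x, s)" by (cases l)
  let ?i = "rev (map (\<lambda>(x, s). (x, \<not> s)) u)"
  have "word_eq R [(x, \<not> s), (x, s)] []"
    using word_eq.cancel[of R x "\<not> s"] by simp
  then have "word_eq R (?i @ ([(x, \<not> s), (x, s)] @ u)) (?i @ ([] @ u))"
    by (intro word_eq.append word_eq.refl)
  then show ?case
    using Cons.IH by (auto simp: l intro: word_eq.trans)
qed

lemma group_presented_group: "group (presented_group R)"
proof (rule groupI)
  fix U assume "U \<in> carrier (presented_group R)"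
  then obtain u where U: "U = word_class R u"
    by (auto simp: presented_group_def)
  let ?V = "word_class R (rev (map (\<lambda>(x, s). (x, \<not> s)) u))"
  have "?V \<otimes>\<^bsub>presented_group R\<^esub> U = word_class R []"
    unfolding U presented_group_mult word_class_eq_iff by (rule word_eq_left_inverse)
  then show "\<exists>V\<in>carrier (presented_group R). V \<otimes>\<^bsub>presented_group R\<^esub> U = \<one>\<^bsub>presented_group R\<^esub>"
    by (intro bexI[of _ ?V]) (auto simp: presented_group_def)
next
  fix U V assume "U \<in> carrier (presented_group R)" "V \<in> carrier (presented_group R)"
  then obtain u v where "U = word_class R u" "V = word_class R v"
    by (auto simp: presented_group_def)
  then show "U \<otimes>\<^bsub>presented_group R\<^esub> V \<in> carrier (presented_group R)"
    by (simp add: presented_group_mult) (simp add: presented_group_def)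
next
  fix U V W
  assume "U \<in> carrier (presented_group R)" "V \<in> carrier (presented_group R)"
    "W \<in> carrier (presented_group R)"
  then obtain u v w where "U = word_class R u" "V = word_class R v" "W = word_class R w"
    by (auto simp: presented_group_def)
  then show "U \<otimes>\<^bsub>presented_group R\<^esub> V \<otimes>\<^bsub>presented_group R\<^esub> W =
      U \<otimes>\<^bsub>presented_group R\<^esub> (V \<otimes>\<^bsub>presented_group R\<^esub> W)"
    by (simp add: presented_group_mult)
next
  show "\<one>\<^bsub>presented_group R\<^esub> \<in> carrier (presented_group R)"
    by (simp add: presented_group_def)
next
  fix U assume "U \<in> carrier (presented_group R)"
  then obtain u where U: "U = word_class R u"
    by (auto simp: presented_group_def)
  have "\<one>\<^bsub>presented_group R\<^esub> = word_class R []"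
    by (simp add: presented_group_def)
  then show "\<one>\<^bsub>presented_group R\<^esub> \<otimes>\<^bsub>presented_group R\<^esub> U = U"
    by (simp add: U presented_group_mult)
qed


section \<open>The semidihedral groups\<close>

datatype sd_gen = Gen_a | Gen_b

text \<open>\<open>semidihedral n\<close> is \<open>SD\<^bsub>8n\<^esub>\<close>: the index is \<open>n\<close>, not the order \<open>8n\<close>. The exponent
  \<open>2n - 1\<close> is a subtraction of natural numbers, so the presentation is the intended one
  only for \<open>n \<ge> 1\<close>.\<close>

definition sd_relations :: "nat \<Rightarrow> (sd_gen word \<times> sd_gen word) set" where
  "sd_relations n =
    {(replicate (4 * n) (Gen_a, True), []),
     (replicate 2 (Gen_b, True), []),
     ([(Gen_b, True), (Gen_a, True), (Gen_b, False)], replicate (2 * n - 1) (Gen_a, True))}"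

definition semidihedral :: "nat \<Rightarrow> sd_gen word set monoid" where
  "semidihedral n = presented_group (sd_relations n)"


section \<open>The prime-coprime graph and the independence number\<close>

text \<open>Finite simple graphs are the \<open>pair_graph\<close>s of the library: an undirected edge is a pair of
  opposite arcs.\<close>

definition prime_coprime_graph :: "('a, 'b) monoid_scheme \<Rightarrow> 'a pair_pre_digraph" where
  "prime_coprime_graph G =
    \<lparr>pverts = carrier G,
     parcs = {(g, h). g \<in> carrier G \<and> h \<in> carrier G \<and> g \<noteq> h \<and>
       (gcd (group.ord G g) (group.ord G h) = 1 \<or>
        prime (gcd (group.ord G g) (group.ord G h)))}\<rparr>"

lemma pair_graph_prime_coprime_graph:
  assumes "finite (carrier G)"
  shows "pair_graph (prime_coprime_graph G)"
proof
  have "parcs (prime_coprime_graph G) \<subseteq> carrier G \<times> carrier G"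
    by (auto simp: prime_coprime_graph_def)
  then show "finite (parcs (prime_coprime_graph G))"
    using assms by (meson finite_SigmaI finite_subset)
  show "symmetric (with_proj (prime_coprime_graph G))"
    unfolding symmetric_def
    by (rule symI) (auto simp: prime_coprime_graph_def arcs_ends_def arc_to_ends_def gcd.commute)
qed (auto simp: prime_coprime_graph_def assms)

definition independent_set :: "'a pair_pre_digraph \<Rightarrow> 'a set \<Rightarrow> bool" where
  "independent_set \<Gamma> S \<longleftrightarrow> S \<subseteq> pverts \<Gamma> \<and> (\<forall>x\<in>S. \<forall>y\<in>S. (x, y) \<notin> parcs \<Gamma>)"

text \<open>Meaningful for finite graphs only.\<close>

definition independence_number :: "'a pair_pre_digraph \<Rightarrow> nat" where
  "independence_number \<Gamma> = Max (card ` {S. independent_set \<Gamma> S})"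

end

theory Submission
  imports Defs
begin

text \<open>
  The elements whose order is divisible by 4 form an independent set: all the pairwise greatest
  common divisors are multiples of 4. These are the \<open>2n\<close> elements \<open>a\<^sup>ib\<close> with \<open>i\<close> odd, which have
  order 4, and the \<open>4n - 2m\<close> powers of \<open>a\<close> outside the subgroup of order \<open>2m\<close>. Conversely, an
  independent set that contains an element of order 4 lies in this set, one that contains an element
  of order 2 is a singleton, and the remaining ones lie in \<open>\<langle>a\<rangle>\<close>, so they have at most
  \<open>4n \<le> 6n - 2m\<close> elements.

  That the presentation does not collapse is seen from its action on the normal forms \<open>a\<^sup>ib\<^sup>e\<close>.
\<close>

section \<open>Independent sets and orders\<close>

lemma independent_set_prime_coprime_graph:
  "independent_set (prime_coprime_graph G) S \<longleftrightarrow> S \<subseteq> carrier G \<and>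
    (\<forall>x\<in>S. \<forall>y\<in>S. x \<noteq> y \<longrightarrow> gcd (group.ord G x) (group.ord G y) \<noteq> 1 \<and>
      \<not> prime (gcd (group.ord G x) (group.ord G y)))"
  unfolding independent_set_def prime_coprime_graph_def by auto

text \<open>The divisors of 4 are 1, 2 and 4. Hence an element of order 4 is adjacent to every other
  vertex whose order is not a multiple of 4.\<close>

lemma gcd_4_cases:
  fixes d :: nat
  shows "gcd d 4 = 1 \<or> prime (gcd d 4) \<or> 4 dvd d"
proof -
  have "gcd d 4 dvd 2 ^ 2" by simp
  then obtain j where j: "j \<le> 2" "gcd d 4 = 2 ^ j"
    using divides_primepow_nat[OF two_is_prime_nat] by blast
  from j(1) have "j = 0 \<or> j = 1 \<or> j = 2" by linarith
  then have "(2::nat) ^ j = 1 \<or> (2::nat) ^ j = 2 \<or> (2::nat) ^ j = 4" by auto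
  then show ?thesis
    unfolding j(2)[symmetric] by (metis gcd_dvd1 two_is_prime_nat)
qed

lemma gcd_2_cases:
  fixes d :: nat
  shows "gcd d 2 = 1 \<or> prime (gcd d 2)"
  by (metis gcd_dvd2 prime_nat_iff two_is_prime_nat)

lemma independent_set_4_dvd_ord:
  "independent_set (prime_coprime_graph G) {x \<in> carrier G. 4 dvd group.ord G x}"
proof -
  have "d \<noteq> 1 \<and> \<not> prime d" if "4 dvd d" for d :: nat
  proof -
    have "2 dvd (4::nat)" by simp
    then have "2 dvd d" using that by (rule dvd_trans)
    then have "d = 2" if "prime d" using that primes_dvd_imp_eq two_is_prime_nat by blast
    with that show ?thesis by auto
  qed
  then show ?thesis by (auto simp: independent_set_prime_coprime_graph)
qed

lemma independent_set_ord_4: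
  assumes "independent_set (prime_coprime_graph G) S" "y \<in> S" "group.ord G y = 4"
  shows "S \<subseteq> {x \<in> carrier G. 4 dvd group.ord G x}"
proof
  fix x assume "x \<in> S"
  then have "x \<in> carrier G" "x = y \<or> \<not> (gcd (group.ord G x) 4 = 1 \<or> prime (gcd (group.ord G x) 4))"
    using assms unfolding independent_set_prime_coprime_graph by (blast, metis)
  then show "x \<in> {x \<in> carrier G. 4 dvd group.ord G x}"
    using gcd_4_cases assms(3) by auto
qed

text \<open>A gcd with 2 is 1 or the prime 2, so an involution is adjacent to all other
  vertices.\<close>

lemma independent_set_ord_2:
  assumes "independent_set (prime_coprime_graph G) S" "y \<in> S" "group.ord G y = 2"
  shows "S = {y}"
proof -
  have "x = y" if "x \<in> S" for x
    using that assms gcd_2_cases unfolding independent_set_prime_coprime_graph by metis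
  then show ?thesis using assms(2) by blast
qed

section \<open>Counting multiples, and divisibility by 4\<close>

lemma card_multiples_below:
  fixes q c :: nat
  assumes "q > 0"
  shows "card {i. i < q * c \<and> q dvd i} = c"
proof -
  have "{i. i < q * c \<and> q dvd i} = (*) q ` {..<c}"
    using assms by (auto simp: dvd_def)
  then show ?thesis using assms by (simp add: card_image inj_on_def)
qed

lemma card_nonmultiples_below:
  fixes q c :: nat
  assumes "q > 0"
  shows "card {i. i < q * c \<and> \<not> q dvd i} = q * c - c"
proof -
  have "{i. i < q * c \<and> \<not> q dvd i} = {..<q * c} - {i. i < q * c \<and> q dvd i}" by auto
  moreover have "card \<dots> = q * c - c"
    using assms by (subst card_Diff_subset) (auto simp: card_multiples_below)
  ultimately show ?thesis by simp
qed

text \<open>Split \<open>d\<close> into a power of 2 and a divisor of \<open>m\<close>; since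
  \<open>m\<close> is odd, \<open>2 * m\<close> has room for just one factor 2. For orders of
  elements this turns divisibility by 4 into the failure of a power equation with exponent
  \<open>2 * m\<close>.\<close>

lemma dvd_twice_odd_part:
  fixes d k m :: nat
  assumes "d dvd 2 ^ k * m" "odd m"
  shows "d dvd 2 * m \<longleftrightarrow> \<not> 4 dvd d"
proof
  assume "d dvd 2 * m"
  show "\<not> 4 dvd d"
  proof
    assume "4 dvd d"
    then have "4 dvd 2 * m" using \<open>d dvd 2 * m\<close> by (rule dvd_trans)
    with \<open>odd m\<close> show False by presburger
  qed
next
  assume "\<not> 4 dvd d"
  obtain x y where d: "d = x * y" "x dvd 2 ^ k" "y dvd m"
    using division_decomp[OF assms(1)] by blast
  obtain j where j: "x = 2 ^ j"
    using d(2) divides_primepow_nat[OF two_is_prime_nat] by blast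
  have "\<not> 2 \<le> j"
  proof
    assume "2 \<le> j"
    then have "(2::nat) ^ 2 dvd 2 ^ j" by (rule le_imp_power_dvd)
    with \<open>\<not> 4 dvd d\<close> show False by (simp add: d(1) j dvd_mult2)
  qed
  then have "j = 0 \<or> j = 1" by auto
  then have "x dvd 2" using j by auto
  with d show "d dvd 2 * m" by (simp add: mult_dvd_mono)
qed

section \<open>Semidihedral groups\<close>

text \<open>Stated for arbitrary groups because it serves twice: inside the locale below, and in the
  presented group while the locale assumptions are still being established.\<close>

lemma (in group) commute_pow:
  assumes [simp]: "x \<in> carrier G" "y \<in> carrier G"
    and yx: "y \<otimes> x = x [^] (r::nat) \<otimes> y"
  shows "y \<otimes> x [^] (i::nat) = x [^] (r * i) \<otimes> y"
proof (induction i)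
  case (Suc i)
  have "y \<otimes> x [^] Suc i = (y \<otimes> x [^] i) \<otimes> x" by (simp add: m_assoc)
  also have "\<dots> = x [^] (r * i) \<otimes> (y \<otimes> x)" by (simp add: Suc m_assoc)
  also have "\<dots> = x [^] (r * i) \<otimes> x [^] r \<otimes> y" by (simp add: yx m_assoc)
  also have "\<dots> = x [^] (r * Suc i) \<otimes> y" by (simp add: nat_pow_mult add.commute)
  finally show ?case .
qed simp

text \<open>Isolates the facts on which the graph argument rests, so that it involves no words.
  \<open>ord_a\<close> and \<open>b_not_power\<close> exclude a collapse of the group;
  \<open>carrier_cases\<close> bounds it from above.\<close>

locale semidihedral_group = group G for G (structure) +
  fixes a b and n :: nat
  assumes n_pos: "n > 0"
    and a_closed [simp]: "a \<in> carrier G"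
    and b_closed [simp]: "b \<in> carrier G"
    and ord_a: "ord a = 4 * n"
    and b_square: "b \<otimes> b = \<one>"
    and b_a: "b \<otimes> a = a [^] (2 * n - 1) \<otimes> b"
    and b_not_power: "b \<noteq> a [^] (i::nat)"
    and carrier_cases: "x \<in> carrier G \<Longrightarrow> (\<exists>i::nat. x = a [^] i \<or> x = a [^] i \<otimes> b)"
begin

section \<open>Rotations \<open>a [^] i\<close> and reflections
  \<open>a [^] i \<otimes> b\<close>\<close>

lemma pow_a_eq_one_iff: "a [^] (i::nat) = \<one> \<longleftrightarrow> 4 * n dvd i"
  using ord_a pow_eq_id[OF a_closed] by simp

lemma pow_a_mod: "a [^] (i::nat) = a [^] (i mod (4 * n))"
proof -
  have "a [^] i = a [^] (4 * n * (i div (4 * n)) + i mod (4 * n))" by simp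
  also have "\<dots> = a [^] (i mod (4 * n))"
    unfolding nat_pow_mult[OF a_closed, symmetric]
    using pow_a_eq_one_iff[of "4 * n * (i div (4 * n))"] by simp
  finally show ?thesis .
qed

lemma b_pow_a: "b \<otimes> a [^] (i::nat) = a [^] ((2 * n - 1) * i) \<otimes> b"
  by (rule commute_pow) (simp_all add: b_a)

text \<open>Moving \<open>b\<close> past \<open>a [^] i\<close> multiplies the exponent by
  \<open>2 * n - 1\<close>, and the two copies of \<open>b\<close> cancel. The result is trivial
  exactly for even \<open>i\<close>, which separates the orders 2 and 4.\<close>

lemma reflection_square: "(a [^] (i::nat) \<otimes> b) [^] (2::nat) = a [^] (2 * n * i)"
proof -
  have "(a [^] i \<otimes> b) [^] (2::nat) = a [^] i \<otimes> (b \<otimes> a [^] i) \<otimes> b"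
    by (simp add: numeral_2_eq_2 m_assoc)
  also have "\<dots> = a [^] i \<otimes> a [^] ((2 * n - 1) * i) \<otimes> (b \<otimes> b)"
    by (simp add: b_pow_a m_assoc)
  also have "\<dots> = a [^] (i + (2 * n - 1) * i)"
    by (simp add: b_square nat_pow_mult)
  also have "i + (2 * n - 1) * i = (1 + (2 * n - 1)) * i" by (simp only: add_mult_distrib)
  also have "\<dots> = 2 * n * i" using n_pos by simp
  finally show ?thesis .
qed

lemma reflection_not_power: "a [^] (i::nat) \<otimes> b \<noteq> a [^] (j::nat)"
proof
  assume eq: "a [^] i \<otimes> b = a [^] j"
  \<comment> \<open>The inverse of \<open>a [^] i\<close> is written with the natural exponent
    \<open>(4 * n - 1) * i\<close>.\<close>
  have "(4 * n - 1) * i + i = ((4 * n - 1) + 1) * i" by (simp only: add_mult_distrib)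
  then have "(4 * n - 1) * i + i = 4 * n * i" using n_pos by simp
  then have "a [^] ((4 * n - 1) * i) \<otimes> a [^] i = \<one>"
    by (simp add: nat_pow_mult pow_a_eq_one_iff)
  then have "b = a [^] ((4 * n - 1) * i) \<otimes> (a [^] i \<otimes> b)"
    by (simp add: m_assoc[symmetric])
  then have "b = a [^] ((4 * n - 1) * i + j)" by (simp add: eq nat_pow_mult)
  with b_not_power show False by blast
qed

text \<open>The fourth power is trivial, so the order is 1, 2 or 4. Order 1 would make the
  reflection equal to \<open>a [^] 0\<close>, and the square decides between the other two.\<close>

lemma ord_reflection: "ord (a [^] (i::nat) \<otimes> b) = (if even i then 2 else 4)"
proof -
  let ?x = "a [^] i \<otimes> b"
  have x: "?x \<in> carrier G" by simp
  have sq: "ord ?x dvd 2 \<longleftrightarrow> even i"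
    using n_pos by (simp add: pow_eq_id[OF x, symmetric] reflection_square pow_a_eq_one_iff)
  have "?x [^] (2 * 2 :: nat) = \<one>"
    unfolding nat_pow_pow[OF x, symmetric]
    by (simp add: reflection_square nat_pow_pow pow_a_eq_one_iff)
  then have "ord ?x dvd 2 ^ 2" using pow_eq_id[OF x] by simp
  then obtain j where j: "j \<le> 2" "ord ?x = 2 ^ j"
    using divides_primepow_nat[OF two_is_prime_nat] by blast
  have "?x \<noteq> \<one>" using reflection_not_power[of i 0] by simp
  then have "ord ?x \<noteq> 1" using pow_eq_id[OF x, of 1] by auto
  moreover from j(1) have "j = 0 \<or> j = 1 \<or> j = 2" by linarith
  ultimately show ?thesis using j(2) sq by auto
qed

section \<open>Counting rotations and elements of order divisible by 4\<close>

lemma inj_on_pow_a: "inj_on (\<lambda>i::nat. a [^] i) {..<4 * n}"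
proof -
  have "{..<4 * n} = {0..4 * n - 1}" using n_pos by auto
  then show ?thesis using ord_inj[OF a_closed] by (simp add: ord_a)
qed

lemma finite_rotations: "finite (range (\<lambda>i::nat. a [^] i))"
  and card_rotations: "card (range (\<lambda>i::nat. a [^] i)) = 4 * n"
proof -
  have "a [^] i \<in> (\<lambda>i::nat. a [^] i) ` {..<4 * n}" for i :: nat
    using pow_a_mod[of i] n_pos by (intro image_eqI[of _ _ "i mod (4 * n)"]) auto
  then have eq: "range (\<lambda>i::nat. a [^] i) = (\<lambda>i::nat. a [^] i) ` {..<4 * n}" by auto
  show "finite (range (\<lambda>i::nat. a [^] i))" "card (range (\<lambda>i::nat. a [^] i)) = 4 * n"
    unfolding eq using card_image[OF inj_on_pow_a] by simp_all
qed

lemma finite_carrier: "finite (carrier G)"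
proof (rule finite_subset)
  show "carrier G \<subseteq> range (\<lambda>i::nat. a [^] i) \<union> (\<lambda>x. x \<otimes> b) ` range (\<lambda>i::nat. a [^] i)"
    using carrier_cases by blast
qed (simp add: finite_rotations)

text \<open>The order divides \<open>4 * n\<close>, so 4 fails to divide it iff the power with
  exponent \<open>2 * m\<close> is trivial, that is, iff \<open>4 * n\<close> divides
  \<open>2 * m * i\<close>. Cancelling \<open>2 * m\<close> from
  \<open>4 * n = 2 * m * 2 ^ (k + 1)\<close> leaves the criterion.\<close>

lemma four_dvd_ord_rotation:
  assumes "n = 2 ^ k * m" "odd m"
  shows "4 dvd ord (a [^] i) \<longleftrightarrow> \<not> 2 ^ (k + 1) dvd (i::nat)"
proof -
  have "(a [^] i) [^] (4 * n) = \<one>"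
    by (simp add: nat_pow_pow pow_a_eq_one_iff)
  then have "ord (a [^] i) dvd 4 * n" using pow_eq_id by simp
  then have "ord (a [^] i) dvd 2 ^ (k + 2) * m" by (simp add: assms(1) mult.assoc)
  then have "4 dvd ord (a [^] i) \<longleftrightarrow> \<not> ord (a [^] i) dvd 2 * m"
    using dvd_twice_odd_part assms(2) by blast
  also have "ord (a [^] i) dvd 2 * m \<longleftrightarrow> 4 * n dvd i * (2 * m)"
    by (simp add: pow_eq_id[symmetric] nat_pow_pow pow_a_eq_one_iff)
  also have "\<dots> \<longleftrightarrow> 2 * m * 2 ^ (k + 1) dvd 2 * m * i"
    by (simp add: assms(1) mult_ac)
  also have "\<dots> \<longleftrightarrow> 2 ^ (k + 1) dvd i"
    using assms(2) unfolding nat_mult_dvd_cancel_disj by auto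
  finally show ?thesis .
qed

lemma card_4_dvd_ord:
  assumes "n = 2 ^ k * m" "odd m"
  shows "card {x \<in> carrier G. 4 dvd ord x} = 6 * n - 2 * m"
proof -
  let ?R = "{i. i < 4 * n \<and> \<not> 2 ^ (k + 1) dvd i}" and ?S = "{i. i < 4 * n \<and> \<not> 2 dvd i}"
  have "{x \<in> carrier G. 4 dvd ord x} = (\<lambda>i. a [^] i) ` ?R \<union> (\<lambda>i. a [^] i \<otimes> b) ` ?S"
  proof (intro equalityI subsetI)
    fix x assume x: "x \<in> {x \<in> carrier G. 4 dvd ord x}"
    then obtain j :: nat where j: "x = a [^] j \<or> x = a [^] j \<otimes> b"
      using carrier_cases by auto
    define i where "i = j mod (4 * n)"
    have i: "i < 4 * n" using n_pos by (simp add: i_def)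
    have "x = a [^] i \<or> x = a [^] i \<otimes> b" using j pow_a_mod[of j] by (simp add: i_def)
    then show "x \<in> (\<lambda>i. a [^] i) ` ?R \<union> (\<lambda>i. a [^] i \<otimes> b) ` ?S"
    proof
      assume "x = a [^] i"
      then show ?thesis using x i four_dvd_ord_rotation[OF assms, of i] by blast
    next
      assume xi: "x = a [^] i \<otimes> b"
      with x have "odd i" by (auto simp: ord_reflection split: if_splits)
      with xi i show ?thesis by blast
    qed
  qed (auto simp: ord_reflection four_dvd_ord_rotation[OF assms, simplified])
  moreover have "card ((\<lambda>i. a [^] i) ` ?R) = 4 * n - 2 * m"
  proof -
    \<comment> \<open>Reading \<open>4 * n\<close> as \<open>2 ^ (k + 1) * (2 * m)\<close> shows
      that exactly \<open>2 * m\<close> indices are multiples of \<open>2 ^ (k + 1)\<close>.\<close>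
    have "card ?R = 4 * n - 2 * m"
      using card_nonmultiples_below[of "2 ^ (k + 1)" "2 * m"] by (simp add: assms(1) mult_ac)
    then show ?thesis
      using inj_on_pow_a by (subst card_image) (auto simp: inj_on_def)
  qed
  moreover have "card ((\<lambda>i. a [^] i \<otimes> b) ` ?S) = 2 * n"
  proof -
    have "card ?S = 2 * n"
      using card_nonmultiples_below[of 2 "2 * n"] by simp
    then show ?thesis
      using inj_on_pow_a by (subst card_image) (auto simp: inj_on_def)
  qed
  moreover have "(\<lambda>i. a [^] i) ` ?R \<inter> (\<lambda>i. a [^] i \<otimes> b) ` ?S = {}"
    using reflection_not_power by (metis (no_types, lifting) disjoint_iff imageE)
  ultimately have "card {x \<in> carrier G. 4 dvd ord x} = 4 * n - 2 * m + 2 * n"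
    by (simp add: card_Un_disjoint)
  \<comment> \<open>Ensures that the truncated subtraction in \<open>4 * n - 2 * m\<close> is a true
    one, so that \<open>2 * n\<close> can be moved inside.\<close>
  moreover have "m \<le> n" by (simp add: assms(1))
  ultimately show ?thesis by simp
qed

section \<open>The maximum over independent sets\<close>

lemma independence_number_semidihedral_group:
  assumes "n = 2 ^ k * m" "odd m"
  shows "independence_number (prime_coprime_graph G) = 6 * n - 2 * m"
  unfolding independence_number_def
proof (rule Max_eqI)
  have "{S. independent_set (prime_coprime_graph G) S} \<subseteq> Pow (carrier G)"
    by (auto simp: independent_set_prime_coprime_graph)
  then show "finite (card ` {S. independent_set (prime_coprime_graph G) S})"
    by (intro finite_imageI finite_subset[OF _ finite_Pow_iff[THEN iffD2, OF finite_carrier]])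
  show "6 * n - 2 * m \<in> card ` {S. independent_set (prime_coprime_graph G) S}"
    unfolding card_4_dvd_ord[OF assms, symmetric]
    by (intro imageI CollectI independent_set_4_dvd_ord)
next
  fix c assume "c \<in> card ` {S. independent_set (prime_coprime_graph G) S}"
  then obtain S where S: "independent_set (prime_coprime_graph G) S" and c: "c = card S"
    by blast
  have m: "m \<le> n" by (simp add: assms(1))
  consider y where "y \<in> S" "ord y = 4" | y where "y \<in> S" "ord y = 2"
    | "\<forall>y\<in>S. ord y \<noteq> 2 \<and> ord y \<noteq> 4"
    by metis
  then show "c \<le> 6 * n - 2 * m"
  proof cases
    case 1
    then have "S \<subseteq> {x \<in> carrier G. 4 dvd ord x}" using independent_set_ord_4[OF S] by simp
    then show ?thesis
      using card_mono[of "{x \<in> carrier G. 4 dvd ord x}" S] finite_carrier card_4_dvd_ord[OF assms]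
      by (simp add: c)
  next
    case 2
    then have "S = {y}" using independent_set_ord_2[OF S] by simp
    then have "c = 1" using c by simp
    then show ?thesis using m n_pos by simp
  next
    case 3
    \<comment> \<open>Every reflection has order 2 or 4, so only rotations remain.\<close>
    have "S \<subseteq> range (\<lambda>i::nat. a [^] i)"
    proof
      fix x assume "x \<in> S"
      then have "x \<in> carrier G" "ord x \<noteq> 2" "ord x \<noteq> 4"
        using S 3 by (auto simp: independent_set_prime_coprime_graph)
      then show "x \<in> range (\<lambda>i::nat. a [^] i)"
        using carrier_cases[of x] by (auto simp: ord_reflection split: if_splits)
    qed
    then have "c \<le> 4 * n" using c card_mono[OF finite_rotations] card_rotations by metis
    then show ?thesis using m by simp
  qed
qed

end

section \<open>Normal forms in the presented group\<close>

text \<open>Left multiplication by a letter on the normal forms \<open>a\<^sup>ib\<^sup>e\<close>, encoded as \<open>(i, e)\<close> with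
  \<open>0 \<le> i < 4n\<close>.\<close>

fun sd_letter :: "nat \<Rightarrow> sd_gen \<times> bool \<Rightarrow> int \<times> bool \<Rightarrow> int \<times> bool" where
  "sd_letter n (Gen_a, s) (i, e) = ((if s then i + 1 else i - 1) mod (4 * int n), e)"
| "sd_letter n (Gen_b, s) (i, e) = (((2 * int n - 1) * i) mod (4 * int n), \<not> e)"

abbreviation sd_act :: "nat \<Rightarrow> sd_gen word \<Rightarrow> int \<times> bool \<Rightarrow> int \<times> bool" where
  "sd_act n \<equiv> foldr (sd_letter n)"

abbreviation sd_forms :: "nat \<Rightarrow> (int \<times> bool) set" where
  "sd_forms n \<equiv> {0..<4 * int n} \<times> UNIV"

text \<open>A letter followed by its inverse sends \<open>i\<close> to its residue modulo
  \<open>4 * n\<close>, which is \<open>i\<close> only for reduced indices. The invariance proof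
  therefore has to stay within \<open>sd_forms n\<close>.\<close>

lemma sd_act_closed:
  assumes "n > 0" "x \<in> sd_forms n"
  shows "sd_act n w x \<in> sd_forms n"
proof (induction w)
  case (Cons l w)
  have "sd_letter n l y \<in> sd_forms n" for y
    using assms(1) by (cases "(n, l, y)" rule: sd_letter.cases) auto
  then show ?case by simp
qed (use assms in simp)

text \<open>This rule would rewrite the action of a \<open>replicate\<close> word to an iterate of
  one letter.\<close>

declare foldr_replicate [simp del]

lemma sd_act_replicate_a:
  assumes "0 \<le> i" "i < 4 * int n"
  shows "sd_act n (replicate j (Gen_a, True)) (i, e) = ((i + int j) mod (4 * int n), e)"
  using assms by (induction j) (simp_all add: mod_simps ac_simps)

text \<open>Since \<open>2 * n - 1\<close> squares to 1 modulo \<open>4 * n\<close>, the letter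
  \<open>Gen_b\<close> acts as an involution, which is why both of its signs can act alike.\<close>

lemma square_semidihedral_exponent:
  "(2 * int n - 1) * ((2 * int n - 1) * i) mod (4 * int n) = i mod (4 * int n)"
proof -
  have "(2 * int n - 1) * ((2 * int n - 1) * i) = i + 4 * int n * ((int n - 1) * i)"
    by (simp add: algebra_simps)
  then show ?thesis by simp
qed

text \<open>Each relation holds for the action, so the action descends to word classes and can tell
  them apart.\<close>

lemma word_eq_sd_act:
  assumes "word_eq (sd_relations n) u v" "n > 0" "x \<in> sd_forms n"
  shows "sd_act n u x = sd_act n v x"
  using assms
proof (induction arbitrary: x rule: word_eq.induct)
  case (append u u' v v')
  then show ?case using sd_act_closed by simp
next
  case (cancel g s)
  obtain i e where x: "x = (i, e)" "0 \<le> i" "i < 4 * int n" using cancel by auto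
  then show ?case
    by (cases g) (simp_all add: mod_simps square_semidihedral_exponent)
next
  case (relation u v)
  obtain i e where x: "x = (i, e)" "0 \<le> i" "i < 4 * int n" using relation by auto
  have r: "int (2 * n - 1) = 2 * int n - 1" using relation.prems by simp
  \<comment> \<open>The index computation behind the conjugation relation: acting by
    \<open>b\<close>, \<open>a\<close>, \<open>b\<close> in turn shifts \<open>i\<close> by
    \<open>2 * n - 1\<close>.\<close>
  have "(2 * int n - 1) * ((2 * int n - 1) * i + 1) mod (4 * int n)
      = ((2 * int n - 1) * ((2 * int n - 1) * i) mod (4 * int n) + (2 * int n - 1)) mod (4 * int n)"
    by (simp add: mod_simps distrib_left)
  also have "\<dots> = (i + (2 * int n - 1)) mod (4 * int n)"
    unfolding square_semidihedral_exponent by (simp add: mod_simps)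
  finally have conj: "(2 * int n - 1) * ((2 * int n - 1) * i + 1) mod (4 * int n)
      = (i + (2 * int n - 1)) mod (4 * int n)" .
  from relation.hyps consider "u = replicate (4 * n) (Gen_a, True)" "v = []"
    | "u = [(Gen_b, True), (Gen_b, True)]" "v = []"
    | "u = [(Gen_b, True), (Gen_a, True), (Gen_b, False)]" "v = replicate (2 * n - 1) (Gen_a, True)"
    unfolding sd_relations_def by (auto simp: numeral_2_eq_2)
  then show ?case
  proof cases
    case 1
    have "sd_act n u x = ((i + int (4 * n)) mod (4 * int n), e)"
      unfolding 1 x(1) by (rule sd_act_replicate_a[OF x(2,3)])
    with x 1(2) show ?thesis by simp
  next
    case 2
    with x show ?thesis by (simp add: mod_simps square_semidihedral_exponent)
  next
    case 3
    have "sd_act n v x = ((i + (2 * int n - 1)) mod (4 * int n), e)"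
      unfolding 3 x(1) using sd_act_replicate_a[OF x(2,3)] r by metis
    then show ?thesis unfolding 3 x(1) by (simp add: mod_simps conj)
  qed
qed auto

section \<open>The presented group satisfies the locale assumptions\<close>

lemma word_class_pow:
  "word_class R u [^]\<^bsub>presented_group R\<^esub> (j::nat) = word_class R (concat (replicate j u))"
proof (induction j)
  case 0
  show ?case by (simp add: presented_group_def)
next
  case (Suc j)
  have "concat (replicate j u) @ u = concat (replicate (Suc j) u)"
    by (induction j) auto
  with Suc show ?case by (simp add: presented_group_mult)
qed

lemma concat_replicate_singleton: "concat (replicate j [x]) = replicate j x"
  by (induction j) auto

lemma semidihedral_group_semidihedral:
  assumes "n > 0"
  shows "semidihedral_group (semidihedral n) (word_class (sd_relations n) [(Gen_a, True)])
    (word_class (sd_relations n) [(Gen_b, True)]) n"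
proof -
  let ?R = "sd_relations n"
  define G where "G = presented_group ?R"
  define cl where "cl = word_class ?R"
  define a where "a = cl [(Gen_a, True)]"
  define b where "b = cl [(Gen_b, True)]"
  interpret group G unfolding G_def by (rule group_presented_group)
  have closed [simp]: "cl w \<in> carrier G" for w by (simp add: G_def cl_def presented_group_def)
  have one: "\<one>\<^bsub>G\<^esub> = cl []" by (simp add: G_def cl_def presented_group_def)
  have mult: "cl u \<otimes>\<^bsub>G\<^esub> cl v = cl (u @ v)" for u v
    by (simp add: G_def cl_def presented_group_mult)
  have rel: "cl u = cl v" if "(u, v) \<in> ?R" for u v
    unfolding cl_def word_class_eq_iff using that by (rule word_eq.relation)
  have [simp]: "a \<in> carrier G" "b \<in> carrier G" by (simp_all add: a_def b_def)
  have pow_a: "a [^]\<^bsub>G\<^esub> j = cl (replicate j (Gen_a, True))" for j :: nat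
    by (simp add: a_def G_def cl_def word_class_pow concat_replicate_singleton)
  \<comment> \<open>\<open>(0, False)\<close> encodes the identity, so acting on it yields the
    normal form of a word.\<close>
  have act: "sd_act n u (0, False) = sd_act n v (0, False)" if "cl u = cl v" for u v
    using that assms by (intro word_eq_sd_act) (auto simp: cl_def word_class_eq_iff)
  have act_pow: "sd_act n (replicate j (Gen_a, True)) (0, False) = (int j mod (4 * int n), False)"
    for j using assms by (simp add: sd_act_replicate_a)
  have a_order: "a [^]\<^bsub>G\<^esub> (4 * n) = \<one>\<^bsub>G\<^esub>"
    unfolding pow_a one by (rule rel) (simp add: sd_relations_def)
  \<comment> \<open>The action shows that no smaller power of \<open>a\<close> is trivial; the
    converse uses only the relation for \<open>a\<close>.\<close>
  have "a [^]\<^bsub>G\<^esub> j = \<one>\<^bsub>G\<^esub> \<longleftrightarrow> 4 * n dvd j" for j :: nat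
  proof
    assume "a [^]\<^bsub>G\<^esub> j = \<one>\<^bsub>G\<^esub>"
    then have "sd_act n (replicate j (Gen_a, True)) (0, False) = (0, False)"
      using act[of "replicate j (Gen_a, True)" "[]"] by (simp add: pow_a one)
    then have "int (4 * n) dvd int j" by (simp add: act_pow mod_0_imp_dvd)
    then show "4 * n dvd j" by (simp only: of_nat_dvd_iff)
  next
    assume "4 * n dvd j"
    then obtain c where "j = 4 * n * c" ..
    then show "a [^]\<^bsub>G\<^esub> j = \<one>\<^bsub>G\<^esub>"
      by (simp add: a_order nat_pow_pow[symmetric])
  qed
  then have ord_a: "ord a = 4 * n" using ord_unique by simp
  have b_square: "b \<otimes>\<^bsub>G\<^esub> b = \<one>\<^bsub>G\<^esub>"
    unfolding b_def mult one by (rule rel) (simp add: sd_relations_def numeral_2_eq_2)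
  have inv_letter: "cl [(g, False)] \<otimes>\<^bsub>G\<^esub> cl [(g, True)] = \<one>\<^bsub>G\<^esub>" for g
    unfolding mult one unfolding cl_def word_class_eq_iff
    using word_eq.cancel[of ?R g False] by simp
  \<comment> \<open>Inverse letters are replaced by positive powers, here \<open>b\<close> itself
    and below \<open>4 * n - 1\<close> copies of \<open>a\<close>, so that natural exponents
    suffice.\<close>
  have inv_b: "cl [(Gen_b, False)] = b"
    using inv_unique[OF inv_letter[of Gen_b, folded b_def] b_square] by simp
  have "a \<otimes>\<^bsub>G\<^esub> a [^]\<^bsub>G\<^esub> (4 * n - 1) = \<one>\<^bsub>G\<^esub>"
    using a_order assms nat_pow_Suc2[of a "4 * n - 1"] by simp
  then have inv_a: "cl [(Gen_a, False)] = a [^]\<^bsub>G\<^esub> (4 * n - 1)"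
    using inv_unique[OF inv_letter[of Gen_a, folded a_def]] by simp
  have "cl [(Gen_b, True)] \<otimes>\<^bsub>G\<^esub> cl [(Gen_a, True)] \<otimes>\<^bsub>G\<^esub> cl [(Gen_b, False)]
      = cl (replicate (2 * n - 1) (Gen_a, True))"
    unfolding mult by (rule rel) (simp add: sd_relations_def)
  then have "b \<otimes>\<^bsub>G\<^esub> a \<otimes>\<^bsub>G\<^esub> b = a [^]\<^bsub>G\<^esub> (2 * n - 1)"
    by (simp only: inv_b pow_a flip: a_def b_def)
  then have b_a: "b \<otimes>\<^bsub>G\<^esub> a = a [^]\<^bsub>G\<^esub> (2 * n - 1) \<otimes>\<^bsub>G\<^esub> b"
    using b_square by (metis \<open>a \<in> carrier G\<close> \<open>b \<in> carrier G\<close> m_assoc m_closed r_one)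
  \<comment> \<open>Acting on \<open>(0, False)\<close>, \<open>b\<close> flips the Boolean
    component, while powers of \<open>a\<close> keep it.\<close>
  have b_not_power: "b \<noteq> a [^]\<^bsub>G\<^esub> j" for j :: nat
    using act[of "[(Gen_b, True)]" "replicate j (Gen_a, True)"] by (auto simp: b_def pow_a act_pow)
  have b_pow: "b \<otimes>\<^bsub>G\<^esub> a [^]\<^bsub>G\<^esub> i = a [^]\<^bsub>G\<^esub> ((2 * n - 1) * i) \<otimes>\<^bsub>G\<^esub> b" for i :: nat
    by (rule commute_pow) (simp_all add: b_a)
  \<comment> \<open>Normal forms are closed under left multiplication by a letter: powers of
    \<open>a\<close> add exponents, and \<open>b\<close> is moved to the right, where it cancels a
    \<open>b\<close> already present.\<close>
  have "\<exists>i::nat. cl w = a [^]\<^bsub>G\<^esub> i \<or> cl w = a [^]\<^bsub>G\<^esub> i \<otimes>\<^bsub>G\<^esub> b" for w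
  proof (induction w)
    case Nil
    show ?case by (intro exI[of _ 0]) (simp add: one)
  next
    case (Cons l w)
    then obtain i :: nat where i: "cl w = a [^]\<^bsub>G\<^esub> i \<or> cl w = a [^]\<^bsub>G\<^esub> i \<otimes>\<^bsub>G\<^esub> b" by blast
    have lw: "cl (l # w) = cl [l] \<otimes>\<^bsub>G\<^esub> cl w" by (simp add: mult)
    obtain g s where l: "l = (g, s)" by (cases l)
    show ?case
    proof (cases g)
      case Gen_a
      then obtain j :: nat where j: "cl [l] = a [^]\<^bsub>G\<^esub> j"
        using inv_a l that[of 1] by (cases s) (auto simp: a_def)
      have "cl (l # w) = a [^]\<^bsub>G\<^esub> (j + i) \<or> cl (l # w) = a [^]\<^bsub>G\<^esub> (j + i) \<otimes>\<^bsub>G\<^esub> b"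
        using i by (auto simp: lw j nat_pow_mult[symmetric] m_assoc)
      then show ?thesis by blast
    next
      case Gen_b
      then have "cl [l] = b" using inv_b l by (cases s) (auto simp: b_def)
      then have bw: "cl (l # w) = b \<otimes>\<^bsub>G\<^esub> cl w" using lw by simp
      have "b \<otimes>\<^bsub>G\<^esub> (a [^]\<^bsub>G\<^esub> i \<otimes>\<^bsub>G\<^esub> b) = (b \<otimes>\<^bsub>G\<^esub> a [^]\<^bsub>G\<^esub> i) \<otimes>\<^bsub>G\<^esub> b"
        by (simp add: m_assoc)
      also have "\<dots> = a [^]\<^bsub>G\<^esub> ((2 * n - 1) * i)"
        unfolding b_pow by (simp add: m_assoc b_square)
      finally have "cl (l # w) = a [^]\<^bsub>G\<^esub> ((2 * n - 1) * i) \<otimes>\<^bsub>G\<^esub> b \<or>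
          cl (l # w) = a [^]\<^bsub>G\<^esub> ((2 * n - 1) * i)"
        using i bw b_pow[of i] by metis
      then show ?thesis by blast
    qed
  qed
  then have "\<exists>i::nat. x = a [^]\<^bsub>G\<^esub> i \<or> x = a [^]\<^bsub>G\<^esub> i \<otimes>\<^bsub>G\<^esub> b" if "x \<in> carrier G" for x
    using that by (auto simp: G_def cl_def presented_group_def)
  then have "semidihedral_group G a b n"
    using assms ord_a b_square b_a b_not_power by unfold_locales auto
  then show ?thesis by (simp add: G_def a_def b_def cl_def semidihedral_def)
qed

theorem proposition3p19:
  fixes n k m :: nat
  assumes "n \<ge> 3"
    and "n = 2 ^ k * m"
    and "odd m"
  shows "int (independence_number (prime_coprime_graph (semidihedral n))) = 6 * int n - 2 * int m"
proof -
  interpret semidihedral_group "semidihedral n" "word_class (sd_relations n) [(Gen_a, True)]"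
    "word_class (sd_relations n) [(Gen_b, True)]" n
    using assms(1) by (intro semidihedral_group_semidihedral) simp
  \<comment> \<open>Makes the natural subtraction agree with the integer one in the
    conclusion.\<close>
  have "m \<le> n" by (simp add: assms(2))
  then show ?thesis
    using independence_number_semidihedral_group[OF assms(2,3)] by (simp add: of_nat_diff)
qed

end
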